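(* Let $(\theta_k)_{k\ge1}$ be complex numbers and $(R_{0k})_{k\ge1}$ be positive real numbers, and let $A_n$ ($n\ge 0$) be the coefficients defined in the context, so that $\sum_{j=1}^n R_{0j}e^{i\theta_j}=A_n e^{i\sum_{j=1}^n\theta_j}$. Then $A_0=0$ and, for every $n\ge 1$, $$A_n=A_{n-1}\,e^{-i\theta_n}+R_{0n}\,e^{-i\sum_{j=1}^{n-1}\theta_j}.$$
   Context: For $n\ge 1$, $$A_n=\Big(\prod_{j=1}^n R_{0j}\Big)\Big(\sum_{j=1}^n e^{-i\sum_{k\ne j}\left(-i\ln R_{0k}+\theta_k\right)}\Big),$$ where $\sum_{k\ne j}$ runs over $k\in\{1,\dots,n\}$, $k\ne j$, and $\ln$ is the real natural logarithm; by convention $A_0=0$. Empty sums are $0$. *)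

theory Defs
  imports Complex_Main
begin

text \<open>The sequences are indexed by k >= 1; the values \<open>R 0\<close> and \<open>\<theta> 0\<close> are never used.
  \<open>R k\<close> is the amplitude written R with double subscript 0k in the source.\<close>

definition A :: "(nat \<Rightarrow> real) \<Rightarrow> (nat \<Rightarrow> complex) \<Rightarrow> nat \<Rightarrow> complex" where
  "A R \<theta> n =
     (if n = 0 then 0
      else (\<Prod>j=1..n. complex_of_real (R j)) *
           (\<Sum>j=1..n. exp (- \<i> * (\<Sum>k\<in>{1..n} - {j}. - \<i> * complex_of_real (ln (R k)) + \<theta> k))))"

end

theory Submission imports Defs begin

text \<open>
  Absorbing each amplitude into its phase, \<open>R k * exp (\<i> * \<theta> k) = exp (\<i> * (\<theta> k - \<i> * ln (R k)))\<close>,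
  turns a product of phasors into one exponential. In the \<open>j\<close>-th summand of \<open>A\<close> the logarithms
  therefore contribute the reciprocal of the product of all amplitudes except \<open>R j\<close>; the
  prefactor cancels it and leaves \<open>R j\<close>. So \<open>A R \<theta> n\<close> is the phasor sum
  \<open>\<Sum>j=1..n. R j * exp (\<i> * \<theta> j)\<close> multiplied by \<open>exp (- \<i> * (\<Sum>j=1..n. \<theta> j))\<close>, which is lemma
  \<open>A_eq_phasor_sum\<close>. The first claim moves the exponential to the other side, and the recursion
  splits off the last term of the phasor sum, whose own phase then cancels.
\<close>

text \<open>
  Since \<open>- \<i> * (- \<i> * ln r) = - ln r\<close>, every factor of the exponential carries one \<open>1 / R k\<close>.
\<close>

lemma prod_amplitude_mult_exp:
  fixes R :: "'a \<Rightarrow> real" and \<theta> :: "'a \<Rightarrow> complex"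
  assumes "finite S" and "\<And>k. k \<in> S \<Longrightarrow> R k > 0"
  shows "(\<Prod>k\<in>S. complex_of_real (R k))
           * exp (- \<i> * (\<Sum>k\<in>S. - \<i> * complex_of_real (ln (R k)) + \<theta> k))
         = exp (- \<i> * (\<Sum>k\<in>S. \<theta> k))"
proof -
  have factor: "complex_of_real (R k) * exp (- \<i> * (- \<i> * complex_of_real (ln (R k)) + \<theta> k))
                  = exp (- \<i> * \<theta> k)" if "k \<in> S" for k
  proof -
    have "complex_of_real (R k) = exp (complex_of_real (ln (R k)))"
      using assms(2)[OF that] by (simp add: exp_of_real)
    then show ?thesis
      by (simp add: algebra_simps flip: exp_add)
  qed
  show ?thesis
    unfolding sum_distrib_left exp_sum[OF assms(1)] prod.distrib[symmetric]
    using factor by (intro prod.cong) simp_all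
qed

lemma A_eq_phasor_sum:
  assumes "\<And>k. k \<ge> 1 \<Longrightarrow> R k > 0"
  shows "A R \<theta> n = (\<Sum>j=1..n. complex_of_real (R j) * exp (\<i> * \<theta> j))
                     * exp (- \<i> * (\<Sum>j=1..n. \<theta> j))"
proof -
  have summand: "(\<Prod>k=1..n. complex_of_real (R k))
      * exp (- \<i> * (\<Sum>k\<in>{1..n} - {j}. - \<i> * complex_of_real (ln (R k)) + \<theta> k))
      = complex_of_real (R j) * exp (\<i> * \<theta> j) * exp (- \<i> * (\<Sum>k=1..n. \<theta> k))"
    (is "_ * ?E = _") if j: "j \<in> {1..n}" for j
  proof -
    have "(\<Prod>k=1..n. complex_of_real (R k)) * ?E
        = complex_of_real (R j) * ((\<Prod>k\<in>{1..n} - {j}. complex_of_real (R k)) * ?E)"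
      using j by (simp add: prod.remove mult.assoc)
    also have "\<dots> = complex_of_real (R j) * exp (- \<i> * (\<Sum>k\<in>{1..n} - {j}. \<theta> k))"
      using assms by (subst prod_amplitude_mult_exp) auto
    also have "\<dots> = complex_of_real (R j) * exp (\<i> * \<theta> j) * exp (- \<i> * (\<Sum>k=1..n. \<theta> k))"
      using j by (simp add: sum.remove[of _ j] algebra_simps flip: exp_add)
    finally show ?thesis .
  qed
  show ?thesis
  proof (cases "n = 0")
    case False
    then have "A R \<theta> n = (\<Sum>j=1..n. (\<Prod>k=1..n. complex_of_real (R k))
        * exp (- \<i> * (\<Sum>k\<in>{1..n} - {j}. - \<i> * complex_of_real (ln (R k)) + \<theta> k)))"
      unfolding A_def by (simp only: if_False sum_distrib_left[of "prod _ _"])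
    also have "\<dots> = (\<Sum>j=1..n. complex_of_real (R j) * exp (\<i> * \<theta> j)
        * exp (- \<i> * (\<Sum>k=1..n. \<theta> k)))"
      using summand by (rule sum.cong[OF refl])
    finally show ?thesis
      by (simp only: sum_distrib_right)
  qed (simp add: A_def)
qed

theorem proposition2p2:
  fixes \<theta> :: "nat \<Rightarrow> complex" and R :: "nat \<Rightarrow> real"
  assumes R_pos: "\<And>k. k \<ge> 1 \<Longrightarrow> R k > 0"
  shows "(\<forall>n. (\<Sum>j=1..n. complex_of_real (R j) * exp (\<i> * \<theta> j))
                = A R \<theta> n * exp (\<i> * (\<Sum>j=1..n. \<theta> j)))
       \<and> A R \<theta> 0 = 0
       \<and> (\<forall>n\<ge>1. A R \<theta> n = A R \<theta> (n - 1) * exp (- \<i> * \<theta> n)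
                + complex_of_real (R n) * exp (- \<i> * (\<Sum>j=1..n-1. \<theta> j)))"
proof (intro conjI allI impI)
  note A_eq = A_eq_phasor_sum[of R \<theta>, OF R_pos]
  show "(\<Sum>j=1..n. complex_of_real (R j) * exp (\<i> * \<theta> j))
          = A R \<theta> n * exp (\<i> * (\<Sum>j=1..n. \<theta> j))" for n
    by (simp add: A_eq mult.assoc flip: exp_add)
  show "A R \<theta> 0 = 0"
    by (simp add: A_def)
  show "A R \<theta> n = A R \<theta> (n - 1) * exp (- \<i> * \<theta> n)
          + complex_of_real (R n) * exp (- \<i> * (\<Sum>j=1..n-1. \<theta> j))" if n_pos: "n \<ge> 1" for n
  proof -
    obtain m where n: "n = Suc m"
      using n_pos by (cases n) auto
    define P where "P = (\<Sum>j=1..m. complex_of_real (R j) * exp (\<i> * \<theta> j))"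
    define t where "t = (\<Sum>j=1..m. \<theta> j)"
    have "A R \<theta> n = (P + complex_of_real (R n) * exp (\<i> * \<theta> n)) * exp (- \<i> * (t + \<theta> n))"
      by (simp add: A_eq n P_def t_def)
    also have "\<dots> = P * exp (- \<i> * t) * exp (- \<i> * \<theta> n) + complex_of_real (R n) * exp (- \<i> * t)"
      by (simp add: algebra_simps flip: exp_add)
    also have "P * exp (- \<i> * t) = A R \<theta> (n - 1)"
      by (simp add: A_eq n P_def t_def)
    finally show ?thesis
      by (simp add: n t_def)
  qed
qed

end
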